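(* Let $A$ be a Banach algebra. Then the following hold. (1) If $\tilde{Z}_1^\ell(A^{**})=A$, then $A$ is a right ideal in $A^{**}$. (2) If $\tilde{Z}_2^\ell(A^{**})=A$, then $A$ is a left ideal in $A^{**}$. (3) If $\tilde{Z}_1^\ell(A^{**})=\tilde{Z}_2^\ell(A^{**})=A$, then $A$ is an ideal in $A^{**}$.
   Context: $A$ is identified with its canonical image in $A^{**}$. For $a,b\in A$, $a'\in A^*$, $a'',b''\in A^{**}$: the first Arens product is given by $\langle a'a,b\rangle=\langle a',ab\rangle$, $\langle a''a',a\rangle=\langle a'',a'a\rangle$, $\langle a''b'',a'\rangle=\langle a'',b''a'\rangle$; the second Arens product $\circ$ is given by $\langle a\circ a',b\rangle=\langle a',ba\rangle$, $\langle a'\circ a'',a\rangle=\langle a'',a\circ a'\rangle$, $\langle a''\circ b'',a'\rangle=\langle b'',a'\circ a''\rangle$. The two products coincide when one of the factors lies in $A$. $\tilde Z_1^\ell(A^{**})=\{a''\in A^{**}: b''\mapsto a''b''\text{ is weak}^*\text{-to-weak continuous on }A^{**}\}$. $\tilde Z_2^\ell(A^{**})=\{a''\in A^{**}: b''\mapsto b''\circ a''\text{ is weak}^*\text{-to-weak continuous on }A^{**}\}$. Here weak$^*$ means $\sigma(A^{**},A^* )$ and weak means $\sigma(A^{**},A^{***})$. *)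

theory Defs
  imports "HOL-Analysis.Analysis"
begin

(* Scalars: the only fields of sort {real_normed_field, euclidean_space}, i.e. finite-dimensional
   over the reals with a multiplicative norm, are the real and the complex numbers.  Both real
   and complex Banach algebras are covered in this way.  No unit is assumed. *)
locale banach_algebra = vector_space smul
  for smul :: "'k::{real_normed_field, euclidean_space} \<Rightarrow>
      'a::{real_normed_algebra, banach} \<Rightarrow> 'a" +
  assumes scale_of_real: "smul (of_real r) x = r *\<^sub>R x"
    and norm_scale: "norm (smul c x) = norm c * norm x"
    and scale_mult_left: "smul c x * y = smul c (x * y)"
    and scale_mult_right: "x * smul c y = smul c (x * y)"

(* Normed spaces with an explicit carrier: the iterated duals of a space over a variable scalar
   field cannot be types. *)
record ('k, 'v) nspace =
  car :: "'v set"
  add :: "'v \<Rightarrow> 'v \<Rightarrow> 'v"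
  scl :: "'k \<Rightarrow> 'v \<Rightarrow> 'v"
  nrm :: "'v \<Rightarrow> real"

definition alg_space ::
    "('k \<Rightarrow> 'a \<Rightarrow> 'a) \<Rightarrow> ('k, 'a::real_normed_vector) nspace" where
  "alg_space smul = \<lparr>car = UNIV, add = (+), scl = smul, nrm = norm\<rparr>"

(* Functionals are extensional, so equality of elements of the dual is equality of functions. *)
definition dual ::
    "('k::real_normed_field, 'v) nspace \<Rightarrow> ('k, 'v \<Rightarrow> 'k) nspace" where
  "dual V = \<lparr>
     car = {f \<in> extensional (car V).
       (\<forall>x\<in>car V. \<forall>y\<in>car V. f (add V x y) = f x + f y) \<and>
       (\<forall>c. \<forall>x\<in>car V. f (scl V c x) = c * f x) \<and>
       (\<exists>B. \<forall>x\<in>car V. norm (f x) \<le> B * nrm V x)},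
     add = (\<lambda>f g. \<lambda>x\<in>car V. f x + g x),
     scl = (\<lambda>c f. \<lambda>x\<in>car V. c * f x),
     nrm = (\<lambda>f. SUP x\<in>{x \<in> car V. nrm V x \<le> 1}. norm (f x))\<rparr>"

definition initial_topology ::
    "'v set \<Rightarrow> ('v \<Rightarrow> 'k::topological_space) set \<Rightarrow> 'v topology" where
  "initial_topology X \<Phi> =
     topology_generated_by (insert X {{x \<in> X. \<phi> x \<in> U} |\<phi> U. \<phi> \<in> \<Phi> \<and> open U})"

definition weak_topology :: "('k::real_normed_field, 'v) nspace \<Rightarrow> 'v topology" where
  "weak_topology V = initial_topology (car V) (car (dual V))"

(* The topology on the dual of V induced by V. *)
definition weak_star_topology ::
    "('k::real_normed_field, 'v) nspace \<Rightarrow> ('v \<Rightarrow> 'k) topology" where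
  "weak_star_topology V = initial_topology (car (dual V)) ((\<lambda>x f. f x) ` car V)"

abbreviation dual_of ::
    "('k::real_normed_field \<Rightarrow> 'a::real_normed_vector \<Rightarrow> 'a) \<Rightarrow> ('k, 'a \<Rightarrow> 'k) nspace" where
  "dual_of smul \<equiv> dual (alg_space smul)"

abbreviation bidual_of ::
    "('k::real_normed_field \<Rightarrow> 'a::real_normed_vector \<Rightarrow> 'a) \<Rightarrow>
      ('k, ('a \<Rightarrow> 'k) \<Rightarrow> 'k) nspace" where
  "bidual_of smul \<equiv> dual (dual_of smul)"

definition canonical ::
    "('k::real_normed_field \<Rightarrow> 'a::real_normed_vector \<Rightarrow> 'a) \<Rightarrow> 'a \<Rightarrow>
      ('a \<Rightarrow> 'k) \<Rightarrow> 'k" where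
  "canonical smul a = (\<lambda>f\<in>car (dual_of smul). f a)"

(* In each Arens product the inner lambdas are a'a and b''a', respectively a o a' and a' o a''. *)
definition arens1 ::
    "('k::real_normed_field \<Rightarrow> 'a::real_normed_algebra \<Rightarrow> 'a) \<Rightarrow>
      (('a \<Rightarrow> 'k) \<Rightarrow> 'k) \<Rightarrow> (('a \<Rightarrow> 'k) \<Rightarrow> 'k) \<Rightarrow> ('a \<Rightarrow> 'k) \<Rightarrow> 'k" where
  "arens1 smul F G = (\<lambda>f\<in>car (dual_of smul). F (\<lambda>a. G (\<lambda>b. f (a * b))))"

definition arens2 ::
    "('k::real_normed_field \<Rightarrow> 'a::real_normed_algebra \<Rightarrow> 'a) \<Rightarrow>
      (('a \<Rightarrow> 'k) \<Rightarrow> 'k) \<Rightarrow> (('a \<Rightarrow> 'k) \<Rightarrow> 'k) \<Rightarrow> ('a \<Rightarrow> 'k) \<Rightarrow> 'k" where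
  "arens2 smul F G = (\<lambda>f\<in>car (dual_of smul). G (\<lambda>a. F (\<lambda>b. f (b * a))))"

definition Z1 ::
    "('k::real_normed_field \<Rightarrow> 'a::real_normed_algebra \<Rightarrow> 'a) \<Rightarrow>
      (('a \<Rightarrow> 'k) \<Rightarrow> 'k) set" where
  "Z1 smul = {F \<in> car (bidual_of smul).
     continuous_map (weak_star_topology (dual_of smul)) (weak_topology (bidual_of smul))
       (\<lambda>G. arens1 smul F G)}"

definition Z2 ::
    "('k::real_normed_field \<Rightarrow> 'a::real_normed_algebra \<Rightarrow> 'a) \<Rightarrow>
      (('a \<Rightarrow> 'k) \<Rightarrow> 'k) set" where
  "Z2 smul = {F \<in> car (bidual_of smul).
     continuous_map (weak_star_topology (dual_of smul)) (weak_topology (bidual_of smul))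
       (\<lambda>G. arens2 smul G F)}"

definition linear_subspace :: "('k, 'v) nspace \<Rightarrow> 'v set \<Rightarrow> bool" where
  "linear_subspace V I \<longleftrightarrow> I \<subseteq> car V \<and> I \<noteq> {} \<and>
     (\<forall>x\<in>I. \<forall>y\<in>I. add V x y \<in> I) \<and> (\<forall>c. \<forall>x\<in>I. scl V c x \<in> I)"

definition right_ideal ::
    "('k, 'v) nspace \<Rightarrow> ('v \<Rightarrow> 'v \<Rightarrow> 'v) \<Rightarrow> 'v set \<Rightarrow> bool" where
  "right_ideal V m I \<longleftrightarrow> linear_subspace V I \<and> (\<forall>x\<in>I. \<forall>y\<in>car V. m x y \<in> I)"

definition left_ideal ::
    "('k, 'v) nspace \<Rightarrow> ('v \<Rightarrow> 'v \<Rightarrow> 'v) \<Rightarrow> 'v set \<Rightarrow> bool" where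
  "left_ideal V m I \<longleftrightarrow> linear_subspace V I \<and> (\<forall>x\<in>I. \<forall>y\<in>car V. m y x \<in> I)"

definition two_sided_ideal ::
    "('k, 'v) nspace \<Rightarrow> ('v \<Rightarrow> 'v \<Rightarrow> 'v) \<Rightarrow> 'v set \<Rightarrow> bool" where
  "two_sided_ideal V m I \<longleftrightarrow> left_ideal V m I \<and> right_ideal V m I"

end

theory Submission
  imports Defs "HOL-Probability.Discrete_Topology"
begin

text \<open>
  The three parts have one source. Let \<open>L\<close> be a weak*-to-weak continuous self-map of the bidual
  that maps the canonical image of the algebra into itself. Then \<open>L\<close> maps the whole bidual into
  the canonical image (\<open>continuous_map_preserves_canonical\<close>): the algebra is weak* dense in its
  bidual, so the range of \<open>L\<close> lies in the weak closure of the algebra, and the algebra is weakly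
  closed because it is complete. Part (1) is the case of left multiplication by an element
  \<open>a\<close> of the algebra, part (2) the case of right multiplication by \<open>a\<close>; both send \<open>b\<close> in the
  algebra to a product in the algebra.

  Density needs only finite-dimensional linear algebra (\<open>finite_interpolation\<close>): on finitely many
  functionals every element of the bidual agrees exactly with evaluation at some point.
  This is enough because finitely many functionals determine a basic weak* neighbourhood.

  Weak closedness (\<open>canonical_separation\<close>) is a Hahn-Banach separation in the bidual. The
  Hahn-Banach theorem is proved for real normed spaces that are types, through minimal sublinear
  functionals. Two devices bring it to the iterated duals, which are carrier sets over a scalar
  field that may be real or complex. First, the restriction of functionals to the unit ball
  embeds a dual isometrically into a type of bounded functions (\<open>ball_values\<close>). Second, a real
  functional \<open>u\<close> of norm at most 1 is the real part of a scalar-valued functional of norm at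
  most 1 (\<open>dual_of_real_functional\<close>), where the real part of a scalar \<open>y\<close> is its inner product
  with 1. The norming functionals obtained in the same way show that the canonical embedding is
  isometric, so that its image is complete, hence closed.
\<close>

section \<open>The Hahn-Banach theorem for real normed spaces\<close>

text \<open>
  An inequality suffices for homogeneity: applied to \<open>inverse r\<close> it gives the equality
  (\<open>sublinear_scale\<close>). The weak form is what the infima below satisfy most directly.
\<close>

definition sublinear :: "('v::real_vector \<Rightarrow> real) \<Rightarrow> bool" where
  "sublinear q \<longleftrightarrow> (\<forall>x y. q (x + y) \<le> q x + q y) \<and> (\<forall>r\<ge>0. \<forall>x. q (r *\<^sub>R x) \<le> r * q x)"

lemma sublinear_add: "sublinear q \<Longrightarrow> q (x + y) \<le> q x + q y"
  by (simp add: sublinear_def)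

lemma sublinear_scale_le: "sublinear q \<Longrightarrow> 0 \<le> r \<Longrightarrow> q (r *\<^sub>R x) \<le> r * q x"
  by (simp add: sublinear_def)

lemma sublinear_0:
  assumes "sublinear q" shows "q 0 = 0"
  using sublinear_add[OF assms, of 0 0] sublinear_scale_le[OF assms, of 0 0] by simp

lemma sublinear_scale:
  assumes q: "sublinear q" and r: "0 \<le> r"
  shows "q (r *\<^sub>R x) = r * q x"
proof (cases "r = 0")
  case True
  then show ?thesis using sublinear_0[OF q] by simp
next
  case False
  with r have "r > 0" by simp
  then have "q x \<le> inverse r * q (r *\<^sub>R x)"
    using sublinear_scale_le[OF q, of "inverse r" "r *\<^sub>R x"] by simp
  then have "r * q x \<le> q (r *\<^sub>R x)"
    using \<open>r > 0\<close> by (simp add: field_simps)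
  with sublinear_scale_le[OF q r, of x] show ?thesis by linarith
qed

lemma sublinear_minus: "sublinear q \<Longrightarrow> - q (- x) \<le> q x"
  using sublinear_add[of q x "- x"] sublinear_0[of q] by simp

text \<open>
  Among the sublinear functionals below \<open>q\<close>, this is the largest one whose value at \<open>- x\<close> is at
  most \<open>- q x\<close>. A linear functional below it therefore agrees with \<open>q\<close> at \<open>x\<close>.
\<close>

definition tilt :: "('v::real_vector \<Rightarrow> real) \<Rightarrow> 'v \<Rightarrow> 'v \<Rightarrow> real" where
  "tilt q x y = (INF t\<in>{0..}. q (y + t *\<^sub>R x) - t * q x)"

lemma tilt_le:
  assumes q: "sublinear q" and t: "0 \<le> t"
  shows "tilt q x y \<le> q (y + t *\<^sub>R x) - t * q x"
  unfolding tilt_def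
proof (rule cINF_lower)
  show "bdd_below ((\<lambda>t. q (y + t *\<^sub>R x) - t * q x) ` {0..})"
  proof (rule bdd_belowI2)
    fix s :: real assume "s \<in> {0..}"
    then have "s * q x = q ((y + s *\<^sub>R x) + (- y))"
      using sublinear_scale[OF q] by simp
    also have "\<dots> \<le> q (y + s *\<^sub>R x) + q (- y)"
      by (rule sublinear_add[OF q])
    finally show "- q (- y) \<le> q (y + s *\<^sub>R x) - s * q x" by simp
  qed
qed (use t in simp)

lemma tilt_greatest:
  "(\<And>t. 0 \<le> t \<Longrightarrow> m \<le> q (y + t *\<^sub>R x) - t * q x) \<Longrightarrow> m \<le> tilt q x y"
  unfolding tilt_def by (rule cINF_greatest) auto

lemma sublinear_tilt:
  assumes q: "sublinear q"
  shows "sublinear (tilt q x)"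
  unfolding sublinear_def
proof (intro conjI allI impI)
  fix y z
  have "tilt q x (y + z) - (q (z + t *\<^sub>R x) - t * q x) \<le> tilt q x y" if t: "0 \<le> t" for t
  proof (rule tilt_greatest)
    fix s :: real assume s: "0 \<le> s"
    have "tilt q x (y + z) \<le> q ((y + s *\<^sub>R x) + (z + t *\<^sub>R x)) - (s + t) * q x"
      using tilt_le[OF q, of "s + t" x "y + z"] s t by (simp add: algebra_simps)
    with sublinear_add[OF q, of "y + s *\<^sub>R x" "z + t *\<^sub>R x"]
    show "tilt q x (y + z) - (q (z + t *\<^sub>R x) - t * q x) \<le> q (y + s *\<^sub>R x) - s * q x"
      by (simp add: algebra_simps)
  qed
  then have "tilt q x (y + z) - tilt q x y \<le> tilt q x z"
    by (intro tilt_greatest) (simp add: algebra_simps)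
  then show "tilt q x (y + z) \<le> tilt q x y + tilt q x z" by simp
next
  fix r :: real and y assume r: "0 \<le> r"
  show "tilt q x (r *\<^sub>R y) \<le> r * tilt q x y"
  proof (cases "r = 0")
    case True
    then show ?thesis using tilt_le[OF q, of 0 x 0] sublinear_0[OF q] by simp
  next
    case False
    with r have "r > 0" by simp
    have "inverse r * tilt q x (r *\<^sub>R y) \<le> tilt q x y"
    proof (rule tilt_greatest)
      fix t :: real assume t: "0 \<le> t"
      have "tilt q x (r *\<^sub>R y) \<le> q (r *\<^sub>R (y + t *\<^sub>R x)) - (r * t) * q x"
        using tilt_le[OF q, of "r * t" x "r *\<^sub>R y"] r t by (simp add: algebra_simps)
      also have "\<dots> = r * (q (y + t *\<^sub>R x) - t * q x)"
        unfolding sublinear_scale[OF q r] by (simp add: algebra_simps)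
      finally show "inverse r * tilt q x (r *\<^sub>R y) \<le> q (y + t *\<^sub>R x) - t * q x"
        using \<open>r > 0\<close> by (simp add: field_simps)
    qed
    then show ?thesis using \<open>r > 0\<close> by (simp add: field_simps)
  qed
qed

lemma tilt_le_self: "sublinear q \<Longrightarrow> tilt q x y \<le> q y"
  using tilt_le[of q 0 x y] by simp

lemma tilt_minus: "sublinear q \<Longrightarrow> tilt q x (- x) \<le> - q x"
  using tilt_le[of q 1 x "- x"] sublinear_0[of q] by simp

text \<open>
  Tilting cannot lower a minimal \<open>q\<close>, so \<open>q\<close> coincides with its tilt in every direction, which
  makes it odd; an odd sublinear functional is linear.
\<close>

lemma minimal_sublinear_linear:
  assumes q: "sublinear q" and minimal: "\<And>q'. sublinear q' \<Longrightarrow> q' \<le> q \<Longrightarrow> q' = q"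
  shows "linear q"
proof
  have odd: "q (- x) = - q x" for x
  proof -
    have "tilt q x = q"
      using minimal sublinear_tilt[OF q] tilt_le_self[OF q] by (simp add: le_fun_def)
    then have "q (- x) \<le> - q x" using tilt_minus[OF q, of x] by simp
    with sublinear_minus[OF q, of "x"] show ?thesis by simp
  qed
  fix x y
  have "- q (x + y) \<le> - q x - q y"
    using sublinear_add[OF q, of "- x" "- y"] odd[of "x + y"] odd[of x] odd[of y]
    by (simp add: add.commute)
  with sublinear_add[OF q, of x y] show "q (x + y) = q x + q y" by simp
  fix r :: real
  show "q (r *\<^sub>R x) = r *\<^sub>R q x"
  proof (cases "0 \<le> r")
    case True then show ?thesis by (simp add: sublinear_scale[OF q])
  next
    case False
    then show ?thesis
      using sublinear_scale[OF q, of "- r" x] odd[of "r *\<^sub>R x"] by simp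
  qed
qed

text \<open>
  The pointwise infimum is finite because every member of the chain lies above
  \<open>- p (- x)\<close>. The chain condition is what makes it subadditive: two members can be replaced by
  the smaller one.
\<close>

lemma sublinear_Inf_chain:
  assumes ne: "C \<noteq> {}" and sub: "\<And>q. q \<in> C \<Longrightarrow> sublinear q" and le: "\<And>q. q \<in> C \<Longrightarrow> q \<le> p"
    and chain: "\<And>q r. q \<in> C \<Longrightarrow> r \<in> C \<Longrightarrow> q \<le> r \<or> r \<le> q"
  obtains u where "sublinear u" "\<And>q. q \<in> C \<Longrightarrow> u \<le> q"
proof
  define u where "u x = (INF q\<in>C. q x)" for x
  have lower: "u x \<le> q x" if "q \<in> C" for q x
    unfolding u_def
  proof (rule cINF_lower[OF _ that])
    show "bdd_below ((\<lambda>q. q x) ` C)"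
    proof (rule bdd_belowI2)
      fix r assume "r \<in> C"
      then show "- p (- x) \<le> r x"
        using sublinear_minus[OF sub, of r x] le_funD[OF le, of r "- x"] by simp
    qed
  qed
  have greatest: "m \<le> u x" if "\<And>q. q \<in> C \<Longrightarrow> m \<le> q x" for m x
    unfolding u_def using ne that by (rule cINF_greatest)
  show "sublinear u"
    unfolding sublinear_def
  proof (intro conjI allI impI)
    fix x y
    have "u (x + y) - r y \<le> u x" if r: "r \<in> C" for r
    proof (rule greatest)
      fix q assume q: "q \<in> C"
      from chain[OF q r] obtain s where s: "s \<in> C" "s \<le> q" "s \<le> r"
        using q r by auto
      have "u (x + y) \<le> s x + s y"
        using lower[OF s(1), of "x + y"] sublinear_add[OF sub[OF s(1)], of x y] by simp
      also have "\<dots> \<le> q x + r y"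
        using s by (intro add_mono) (auto simp: le_fun_def)
      finally show "u (x + y) - r y \<le> q x" by simp
    qed
    then have "u (x + y) - u x \<le> u y"
      by (intro greatest) (simp add: algebra_simps)
    then show "u (x + y) \<le> u x + u y" by simp
  next
    fix r :: real and x assume r: "0 \<le> r"
    show "u (r *\<^sub>R x) \<le> r * u x"
    proof (cases "r = 0")
      case True
      from ne obtain q where "q \<in> C" by blast
      then show ?thesis using True lower[of q 0] sublinear_0[OF sub[OF \<open>q \<in> C\<close>]] by simp
    next
      case False
      with r have "r > 0" by simp
      have "inverse r * u (r *\<^sub>R x) \<le> u x"
      proof (rule greatest)
        fix q assume q: "q \<in> C"
        show "inverse r * u (r *\<^sub>R x) \<le> q x"
          using lower[OF q, of "r *\<^sub>R x"] sublinear_scale[OF sub[OF q] r, of x] \<open>r > 0\<close>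
          by (simp add: field_simps)
      qed
      then show ?thesis using \<open>r > 0\<close> by (simp add: field_simps)
    qed
  qed
  show "u \<le> q" if "q \<in> C" for q
    using lower[OF that] by (simp add: le_fun_def)
qed

text \<open>
  Zorn's lemma yields a minimal sublinear functional below the tilt of \<open>p\<close>. Starting from the
  tilt instead of \<open>p\<close> forces the value at \<open>x0\<close>.
\<close>

theorem Hahn_Banach_sublinear:
  assumes p: "sublinear p"
  shows "\<exists>u. linear u \<and> (\<forall>x. u x \<le> p x) \<and> u x0 = p x0"
proof -
  let ?A = "{q. sublinear q \<and> q \<le> tilt p x0}"
  let ?P = "\<lambda>q r :: _ \<Rightarrow> real. r \<le> q"
  have "\<exists>m\<in>?A. \<forall>q\<in>?A. ?P m q \<longrightarrow> q = m"
  proof (rule predicate_Zorn)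
    show "partial_order_on ?A (relation_of ?P ?A)"
      by (rule partial_order_on_relation_ofI) auto
    fix C assume C: "C \<in> Chains (relation_of ?P ?A)"
    then have sub: "C \<subseteq> ?A" and chain: "\<And>q r. q \<in> C \<Longrightarrow> r \<in> C \<Longrightarrow> q \<le> r \<or> r \<le> q"
      unfolding Chains_def relation_of_def by auto
    show "\<exists>u\<in>?A. \<forall>q\<in>C. ?P q u"
    proof (cases "C = {}")
      case True
      then show ?thesis using sublinear_tilt[OF p] by blast
    next
      case False
      obtain u where "sublinear u" and u: "\<And>q. q \<in> C \<Longrightarrow> u \<le> q"
        by (rule sublinear_Inf_chain[OF False _ _ chain, of "tilt p x0"]) (use sub in auto)
      moreover have "u \<le> tilt p x0"
      proof -
        obtain q where "q \<in> C" using False by blast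
        then show ?thesis using u[of q] sub by (blast intro: order_trans)
      qed
      ultimately show ?thesis by blast
    qed
  qed
  then obtain u where u: "sublinear u" "u \<le> tilt p x0"
    and minimal: "\<And>q. sublinear q \<Longrightarrow> q \<le> u \<Longrightarrow> q = u"
    by (blast intro: order_trans)
  have "linear u"
    by (rule minimal_sublinear_linear[OF u(1) minimal])
  have le: "u x \<le> tilt p x0 x" for x
    using u(2) by (simp add: le_fun_def)
  have le_p: "u x \<le> p x" for x
    using le tilt_le_self[OF p] by (rule order_trans)
  have "- u x0 \<le> - p x0"
    using le[of "- x0"] tilt_minus[OF p, of x0] linear_neg[OF \<open>linear u\<close>, of x0] by simp
  with le_p[of x0] have "u x0 = p x0" by simp
  with \<open>linear u\<close> le_p show ?thesis by blast
qed

lemma sublinear_infdist: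
  fixes S :: "'v::real_normed_vector set"
  assumes S: "subspace S"
  shows "sublinear (\<lambda>x. infdist x S)"
proof -
  have ne: "S \<noteq> {}" using subspace_0[OF S] by blast
  have greatest: "m \<le> infdist x S" if "\<And>s. s \<in> S \<Longrightarrow> m \<le> norm (x - s)" for m x
    unfolding infdist_notempty[OF ne] using ne
    by (rule cINF_greatest) (simp add: that dist_norm)
  have lower: "infdist x S \<le> norm (x - s)" if "s \<in> S" for x s
    using infdist_le[OF that] by (simp add: dist_norm)
  show ?thesis
    unfolding sublinear_def
  proof (intro conjI allI impI)
    fix x y :: 'v
    have "infdist (x + y) S - norm (y - t) \<le> infdist x S" if t: "t \<in> S" for t
    proof (rule greatest)
      fix s assume s: "s \<in> S"
      have "infdist (x + y) S \<le> norm ((x - s) + (y - t))"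
        using lower[OF subspace_add[OF S s t], of "x + y"] by (simp add: algebra_simps)
      also have "\<dots> \<le> norm (x - s) + norm (y - t)" by (rule norm_triangle_ineq)
      finally show "infdist (x + y) S - norm (y - t) \<le> norm (x - s)" by simp
    qed
    then have "infdist (x + y) S - infdist x S \<le> infdist y S"
      by (intro greatest) (simp add: algebra_simps)
    then show "infdist (x + y) S \<le> infdist x S + infdist y S" by simp
  next
    fix r :: real and x :: 'v assume r: "0 \<le> r"
    show "infdist (r *\<^sub>R x) S \<le> r * infdist x S"
    proof (cases "r = 0")
      case True
      then show ?thesis using subspace_0[OF S] by simp
    next
      case False
      with r have "r > 0" by simp
      have "inverse r * infdist (r *\<^sub>R x) S \<le> infdist x S"
      proof (rule greatest)
        fix s assume "s \<in> S"
        then have "infdist (r *\<^sub>R x) S \<le> norm (r *\<^sub>R (x - s))"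
          using lower[OF subspace_scale[OF S], of s "r *\<^sub>R x" r] by (simp add: algebra_simps)
        also have "\<dots> = r * norm (x - s)" using r by simp
        finally show "inverse r * infdist (r *\<^sub>R x) S \<le> norm (x - s)"
          using \<open>r > 0\<close> by (simp add: field_simps)
      qed
      then show ?thesis using \<open>r > 0\<close> by (simp add: field_simps)
    qed
  qed
qed

text \<open>
  The distance to the subspace is sublinear, and a linear functional below it is bounded by the
  norm and vanishes on the subspace.
\<close>

corollary Hahn_Banach_subspace:
  fixes S :: "'v::real_normed_vector set"
  assumes S: "subspace S" and "closed S" and "x0 \<notin> S"
  obtains u where "linear u" "\<And>x. \<bar>u x\<bar> \<le> norm x" "\<And>x. x \<in> S \<Longrightarrow> u x = 0"
    "u x0 = infdist x0 S" "u x0 > 0"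
proof -
  obtain u where u: "linear u" and le: "\<And>x. u x \<le> infdist x S" and at: "u x0 = infdist x0 S"
    using Hahn_Banach_sublinear[OF sublinear_infdist[OF S], of x0] by blast
  have two: "\<bar>u x\<bar> \<le> m" if "infdist x S \<le> m" "infdist (- x) S \<le> m" for x m
    using le[of x] le[of "- x"] that linear_neg[OF u, of x] by linarith
  show thesis
  proof (rule that[OF u])
    show "\<bar>u x\<bar> \<le> norm x" for x
      using infdist_le[OF subspace_0[OF S], of x] infdist_le[OF subspace_0[OF S], of "- x"]
      by (intro two) simp_all
    show "u x = 0" if "x \<in> S" for x
      using two[of x 0] that subspace_neg[OF S that] by simp
    show "u x0 > 0"
      using at infdist_pos_not_in_closed[OF \<open>closed S\<close> _ \<open>x0 \<notin> S\<close>] subspace_0[OF S] by auto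
  qed (rule at)
qed

corollary Hahn_Banach_norming:
  fixes x0 :: "'v::real_normed_vector"
  obtains u where "linear u" "\<And>x. \<bar>u x\<bar> \<le> norm x" "u x0 = norm x0"
proof -
  have s: "sublinear (norm :: 'v \<Rightarrow> real)"
    unfolding sublinear_def by (auto simp: norm_triangle_ineq)
  obtain u where u: "linear u" and le: "\<And>x. u x \<le> norm x" and at: "u x0 = norm x0"
    using Hahn_Banach_sublinear[OF s, of x0] by blast
  have "\<bar>u x\<bar> \<le> norm x" for x
    using le[of x] le[of "- x"] linear_neg[OF u, of x] by simp
  with u at show thesis using that by blast
qed

section \<open>Scalars as real functionals\<close>

lemma inner_mult_one_inj:
  fixes y :: "'k::{real_normed_field, euclidean_space}"
  assumes "\<And>c. (y * c) \<bullet> 1 = 0"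
  shows "y = 0"
proof (rule ccontr)
  assume "y \<noteq> 0"
  then have "(1::'k) \<bullet> 1 = 0" using assms[of "inverse y"] by simp
  then show False by simp
qed

text \<open>
  In the real and in the complex numbers, the inner product with 1 is the real part. The bilinear
  form that maps \<open>y\<close> and \<open>c\<close> to the real part of \<open>y * c\<close> is nondegenerate, so every real-linear
  functional \<open>v\<close> on the scalars is represented by a unique scalar. This treats both fields at
  once.
\<close>

lemma ex1_representer:
  fixes v :: "'k::{real_normed_field, euclidean_space} \<Rightarrow> real"
  assumes v: "linear v"
  shows "\<exists>!y. \<forall>c. (y * c) \<bullet> 1 = v c"
proof (rule ex_ex1I)
  have lin: "linear (\<lambda>c. (y * c) \<bullet> 1)" for y :: 'k
    by (rule linearI) (simp_all add: algebra_simps inner_simps)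
  define g :: "'k \<Rightarrow> 'k" where "g y = (\<Sum>b\<in>Basis. ((y * b) \<bullet> 1) *\<^sub>R b)" for y
  have g_b: "g y \<bullet> b = (y * b) \<bullet> 1" if "b \<in> Basis" for y b
    using that by (simp add: g_def)
  have g: "linear g"
    by (rule linearI)
       (simp_all add: g_def algebra_simps inner_simps sum.distrib scaleR_sum_right)
  have "inj g"
    unfolding linear_injective_0[OF g]
  proof (intro allI impI)
    fix y assume "g y = 0"
    then have "\<And>b. b \<in> Basis \<Longrightarrow> (y * b) \<bullet> 1 = 0" using g_b[of _ y] by simp
    then have "(\<lambda>c. (y * c) \<bullet> 1) = (\<lambda>c. 0)"
      by (rule linear_eq_stdbasis[OF lin linear_zero])
    then have "(y * c) \<bullet> 1 = 0" for c by (rule fun_cong)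
    then show "y = 0" by (rule inner_mult_one_inj)
  qed
  then have "surj g" by (rule linear_inj_imp_surj[OF g])
  then obtain y where y: "(\<Sum>b\<in>Basis. v b *\<^sub>R b) = g y"
    using surjD[of g] by blast
  have "(y * b) \<bullet> 1 = v b" if "b \<in> Basis" for b
    using g_b[OF that, of y] that by (simp flip: y)
  then have "(\<lambda>c. (y * c) \<bullet> 1) = v"
    by (rule linear_eq_stdbasis[OF lin v])
  then show "\<exists>y. \<forall>c. (y * c) \<bullet> 1 = v c" by (auto simp: fun_eq_iff)
next
  fix y z :: 'k assume "\<forall>c. (y * c) \<bullet> 1 = v c" "\<forall>c. (z * c) \<bullet> 1 = v c"
  then have "\<And>c. ((y - z) * c) \<bullet> 1 = 0" by (simp add: algebra_simps inner_simps)
  then show "y = z" using inner_mult_one_inj[of "y - z"] by simp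
qed

definition representer :: "('k::{real_normed_field, euclidean_space} \<Rightarrow> real) \<Rightarrow> 'k" where
  "representer v = (THE y. \<forall>c. (y * c) \<bullet> 1 = v c)"

lemma representer: "linear v \<Longrightarrow> (representer v * c) \<bullet> 1 = v c"
  unfolding representer_def using theI'[OF ex1_representer] by blast

lemma representer_eqI: "linear v \<Longrightarrow> (\<And>c. (y * c) \<bullet> 1 = v c) \<Longrightarrow> representer v = y"
  unfolding representer_def by (rule the1_equality[OF ex1_representer]) auto

text \<open>
  Evaluating at the inverse of the representing scalar \<open>y\<close> gives 1, hence \<open>1 \<le> M * norm (inverse y)\<close>.
  The constant does not deteriorate because the norm is multiplicative.
\<close>

lemma norm_representer_le:
  assumes v: "linear v" and le: "\<And>c. \<bar>v c\<bar> \<le> M * norm c"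
  shows "norm (representer v) \<le> M"
proof (cases "representer v = 0")
  case True
  have "0 \<le> M" using le[of 1] by (simp add: order_trans[OF abs_ge_zero])
  with True show ?thesis by simp
next
  case False
  let ?y = "representer v"
  have "1 = v (inverse ?y)"
    using representer[OF v, of "inverse ?y"] False by (simp add: dot_square_norm)
  also have "\<dots> \<le> M * norm (inverse ?y)" using le[of "inverse ?y"] by simp
  finally have "1 \<le> M * inverse (norm ?y)" by (simp only: norm_inverse)
  then show ?thesis using False by (simp add: field_simps)
qed

section \<open>Dual spaces\<close>

lemma car_dual:
  "f \<in> car (dual V) \<longleftrightarrow> f \<in> extensional (car V) \<and>
     (\<forall>x\<in>car V. \<forall>y\<in>car V. f (add V x y) = f x + f y) \<and>
     (\<forall>c. \<forall>x\<in>car V. f (scl V c x) = c * f x) \<and>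
     (\<exists>B. \<forall>x\<in>car V. norm (f x) \<le> B * nrm V x)"
  by (simp add: dual_def)

lemma add_dual: "add (dual V) f g = (\<lambda>x\<in>car V. f x + g x)"
  and scl_dual: "scl (dual V) c f = (\<lambda>x\<in>car V. c * f x)"
  and nrm_dual: "nrm (dual V) f = (SUP x\<in>{x \<in> car V. nrm V x \<le> 1}. norm (f x))"
  by (simp_all add: dual_def)

lemma dual_add: "f \<in> car (dual V) \<Longrightarrow> x \<in> car V \<Longrightarrow> y \<in> car V \<Longrightarrow> f (add V x y) = f x + f y"
  and dual_scl: "f \<in> car (dual V) \<Longrightarrow> x \<in> car V \<Longrightarrow> f (scl V c x) = c * f x"
  by (simp_all add: car_dual)

lemma dual_eqI:
  "f \<in> car (dual V) \<Longrightarrow> g \<in> car (dual V) \<Longrightarrow> (\<And>x. x \<in> car V \<Longrightarrow> f x = g x) \<Longrightarrow> f = g"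
  unfolding car_dual by (blast intro: extensionalityI)

text \<open>
  The fragment of the axioms of a seminormed space that passes from a space to its dual and
  suffices for the Hahn-Banach theorem there. Proving that duals inherit it gives the bidual and
  its dual without further work.
\<close>

locale scaled_space =
  fixes V :: "('k::real_normed_field, 'v) nspace"
  assumes add_closed: "x \<in> car V \<Longrightarrow> y \<in> car V \<Longrightarrow> add V x y \<in> car V"
    and scl_closed: "x \<in> car V \<Longrightarrow> scl V c x \<in> car V"
    and scl_add_right: "x \<in> car V \<Longrightarrow> y \<in> car V \<Longrightarrow> scl V c (add V x y) = add V (scl V c x) (scl V c y)"
    and scl_add_left: "x \<in> car V \<Longrightarrow> scl V (c + d) x = add V (scl V c x) (scl V d x)"
    and scl_scl: "x \<in> car V \<Longrightarrow> scl V c (scl V d x) = scl V (c * d) x"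
    and scl_one: "x \<in> car V \<Longrightarrow> scl V 1 x = x"
    and nrm_nonneg: "x \<in> car V \<Longrightarrow> 0 \<le> nrm V x"
    and nrm_scl_le: "x \<in> car V \<Longrightarrow> nrm V (scl V c x) \<le> norm c * nrm V x"
    and zero_exists: "\<exists>z\<in>car V. nrm V z = 0"
begin

lemma ball_nonempty: "{x \<in> car V. nrm V x \<le> 1} \<noteq> {}"
  using zero_exists by auto

lemma norm_le_nrm_dual:
  assumes f: "f \<in> car (dual V)" and x: "x \<in> car V" "nrm V x \<le> 1"
  shows "norm (f x) \<le> nrm (dual V) f"
  unfolding nrm_dual
proof (rule cSUP_upper)
  obtain B where B: "\<And>x. x \<in> car V \<Longrightarrow> norm (f x) \<le> B * nrm V x"
    using f unfolding car_dual by blast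
  show "bdd_above ((\<lambda>x. norm (f x)) ` {x \<in> car V. nrm V x \<le> 1})"
  proof (rule bdd_aboveI2)
    fix y assume y: "y \<in> {x \<in> car V. nrm V x \<le> 1}"
    then have "B * nrm V y \<le> \<bar>B\<bar> * 1"
      using nrm_nonneg by (intro mult_mono) auto
    with B[of y] y show "norm (f y) \<le> \<bar>B\<bar>" by simp
  qed
qed (use x in simp)

lemma nrm_dual_le:
  assumes "\<And>x. x \<in> car V \<Longrightarrow> nrm V x \<le> 1 \<Longrightarrow> norm (f x) \<le> M"
  shows "nrm (dual V) f \<le> M"
  unfolding nrm_dual using ball_nonempty by (rule cSUP_least) (use assms in auto)

lemma nrm_dual_nonneg: "f \<in> car (dual V) \<Longrightarrow> 0 \<le> nrm (dual V) f"
  using zero_exists norm_le_nrm_dual[of f] by (force intro: order_trans[OF norm_ge_zero])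

lemma norm_dual_le:
  assumes f: "f \<in> car (dual V)" and x: "x \<in> car V"
  shows "norm (f x) \<le> nrm (dual V) f * nrm V x"
proof (cases "nrm V x = 0")
  case True
  moreover obtain B where "norm (f x) \<le> B * nrm V x"
    using f x unfolding car_dual by blast
  ultimately show ?thesis by simp
next
  case False
  then have pos: "nrm V x > 0" using nrm_nonneg[OF x] by simp
  let ?c = "of_real (inverse (nrm V x)) :: 'k"
  have c: "norm ?c = inverse (nrm V x)"
    using pos by (simp only: norm_of_real abs_of_pos positive_imp_inverse_positive)
  have "norm (f (scl V ?c x)) \<le> nrm (dual V) f"
    using nrm_scl_le[OF x, of ?c] pos unfolding c by (intro norm_le_nrm_dual f scl_closed x) simp
  then have "inverse (nrm V x) * norm (f x) \<le> nrm (dual V) f"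
    unfolding dual_scl[OF f x] norm_mult c .
  then show ?thesis using pos by (simp add: field_simps)
qed

lemma dualI:
  assumes "f \<in> extensional (car V)"
    and "\<And>x y. x \<in> car V \<Longrightarrow> y \<in> car V \<Longrightarrow> f (add V x y) = f x + f y"
    and "\<And>c x. x \<in> car V \<Longrightarrow> f (scl V c x) = c * f x"
    and "\<And>x. x \<in> car V \<Longrightarrow> norm (f x) \<le> B * nrm V x"
  shows "f \<in> car (dual V)"
  using assms unfolding car_dual by blast

lemma scaled_space_dual: "scaled_space (dual V)"
proof
  fix f g :: "'v \<Rightarrow> 'k" and c d :: 'k
  assume f: "f \<in> car (dual V)"
  show "add (dual V) f g \<in> car (dual V)" if g: "g \<in> car (dual V)"
  proof (rule dualI[where B = "nrm (dual V) f + nrm (dual V) g"])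
    fix x assume x: "x \<in> car V"
    have "norm (f x + g x) \<le> norm (f x) + norm (g x)" by (rule norm_triangle_ineq)
    with norm_dual_le[OF f x] norm_dual_le[OF g x]
    show "norm (add (dual V) f g x) \<le> (nrm (dual V) f + nrm (dual V) g) * nrm V x"
      using x by (simp add: add_dual algebra_simps)
  qed (simp_all add: add_dual add_closed scl_closed dual_add[OF f] dual_add[OF g]
      dual_scl[OF f] dual_scl[OF g] algebra_simps)
  show "scl (dual V) c f \<in> car (dual V)"
  proof (rule dualI[where B = "norm c * nrm (dual V) f"])
    fix x assume x: "x \<in> car V"
    show "norm (scl (dual V) c f x) \<le> norm c * nrm (dual V) f * nrm V x"
      using mult_left_mono[OF norm_dual_le[OF f x] norm_ge_zero[of c]] x
      by (simp add: scl_dual norm_mult mult.assoc)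
  qed (simp_all add: scl_dual add_closed scl_closed dual_add[OF f] dual_scl[OF f] algebra_simps)
  show "scl (dual V) c (add (dual V) f g) = add (dual V) (scl (dual V) c f) (scl (dual V) c g)"
    by (auto simp: add_dual scl_dual algebra_simps)
  show "scl (dual V) (c + d) f = add (dual V) (scl (dual V) c f) (scl (dual V) d f)"
    by (auto simp: add_dual scl_dual algebra_simps)
  show "scl (dual V) c (scl (dual V) d f) = scl (dual V) (c * d) f"
    by (auto simp: scl_dual)
  show "scl (dual V) 1 f = f"
    using f by (auto simp: scl_dual car_dual extensional_def)
  show "0 \<le> nrm (dual V) f" by (rule nrm_dual_nonneg[OF f])
  show "nrm (dual V) (scl (dual V) c f) \<le> norm c * nrm (dual V) f"
    by (rule nrm_dual_le)
       (simp add: scl_dual norm_mult mult_left_mono norm_le_nrm_dual[OF f])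
next
  let ?z = "\<lambda>x\<in>car V. 0 :: 'k"
  have "?z \<in> car (dual V)"
    by (rule dualI[where B = 0]) (simp_all add: add_closed scl_closed)
  moreover have "nrm (dual V) ?z \<le> 0" by (rule nrm_dual_le) simp
  ultimately show "\<exists>z\<in>car (dual V). nrm (dual V) z = 0"
    using nrm_dual_nonneg by (intro bexI[of _ ?z]) (auto intro: antisym)
qed

end

lemma (in scaled_space) linear_scl_functional:
  fixes u :: "'v \<Rightarrow> real"
  assumes add: "\<And>x y. x \<in> car V \<Longrightarrow> y \<in> car V \<Longrightarrow> u (add V x y) = u x + u y"
    and scl: "\<And>r x. x \<in> car V \<Longrightarrow> u (scl V (of_real r) x) = r * u x"
    and x: "x \<in> car V"
  shows "linear (\<lambda>c. u (scl V c x))"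
proof (rule linearI)
  show "u (scl V (c + d) x) = u (scl V c x) + u (scl V d x)" for c d
    using x by (simp add: scl_add_left add scl_closed)
  show "u (scl V (r *\<^sub>R c) x) = r *\<^sub>R u (scl V c x)" for r c
    using scl[OF scl_closed[OF x], of r c] x by (simp add: scl_scl scaleR_conv_of_real)
qed

text \<open>
  For fixed \<open>x\<close>, the map from \<open>c\<close> to \<open>u (c x)\<close> is a real functional on the scalars, and the value
  at \<open>x\<close> is the scalar that represents it. For the complex numbers this is the classical
  \<open>f x = u x - \<i> u (\<i> x)\<close>. Linearity over the scalars follows from uniqueness of the
  representing scalar.
\<close>

lemma dual_of_real_functional:
  fixes V :: "('k::{real_normed_field, euclidean_space}, 'v) nspace" and u :: "'v \<Rightarrow> real"
  assumes V: "scaled_space V"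
    and add: "\<And>x y. x \<in> car V \<Longrightarrow> y \<in> car V \<Longrightarrow> u (add V x y) = u x + u y"
    and scl: "\<And>r x. x \<in> car V \<Longrightarrow> u (scl V (of_real r) x) = r * u x"
    and bound: "\<And>x. x \<in> car V \<Longrightarrow> \<bar>u x\<bar> \<le> nrm V x"
  obtains f where "f \<in> car (dual V)" "\<And>x c. x \<in> car V \<Longrightarrow> (f x * c) \<bullet> 1 = u (scl V c x)"
    "\<And>x. x \<in> car V \<Longrightarrow> norm (f x) \<le> nrm V x"
proof
  interpret scaled_space V by fact
  note lin = linear_scl_functional[OF add scl]
  define f where "f = (\<lambda>x\<in>car V. representer (\<lambda>c. u (scl V c x)))"
  have f_eqI: "f x = y" if "x \<in> car V" "\<And>c. (y * c) \<bullet> 1 = u (scl V c x)" for x y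
    using that lin unfolding f_def by (simp add: representer_eqI)
  show f: "(f x * c) \<bullet> 1 = u (scl V c x)" if x: "x \<in> car V" for x c
    using x by (simp add: f_def representer lin)
  show norm: "norm (f x) \<le> nrm V x" if x: "x \<in> car V" for x
  proof -
    have "\<bar>u (scl V c x)\<bar> \<le> nrm V x * norm c" for c
      using order_trans[OF bound[OF scl_closed[OF x]] nrm_scl_le[OF x, of c]]
      by (simp add: mult.commute)
    then show ?thesis
      using x by (simp add: f_def norm_representer_le lin)
  qed
  show "f \<in> car (dual V)"
  proof (rule dualI[where B = 1])
    show "f \<in> extensional (car V)" by (simp add: f_def)
    show "f (add V x y) = f x + f y" if "x \<in> car V" "y \<in> car V" for x y
      using that
      by (intro f_eqI) (simp_all add: add_closed scl_add_right scl_closed add f distrib_right inner_add_left)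
    show "f (scl V c x) = c * f x" if "x \<in> car V" for c x
      using that f[OF that, of "_ * c"]
      by (intro f_eqI) (simp_all add: scl_closed scl_scl mult.commute mult.left_commute)
  qed (use norm in simp)
qed

section \<open>Separation in a dual space\<close>

text \<open>
  A dual is a carrier set and not a type, while the Hahn-Banach theorem above is about types. The
  discrete topology on the domain makes all bounded functions continuous, so that the target is
  the Banach space of all bounded functions with the supremum norm.
\<close>

definition ball_values ::
    "('k::real_normed_field, 'v) nspace \<Rightarrow> ('v \<Rightarrow> 'k) \<Rightarrow> ('v discrete \<Rightarrow>\<^sub>C 'k)" where
  "ball_values W F = Bcontfun (\<lambda>d. if of_discrete d \<in> car W \<and> nrm W (of_discrete d) \<le> 1
     then F (of_discrete d) else 0)"

context scaled_space
begin

lemma ball_values: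
  assumes F: "F \<in> car (dual V)"
  shows "apply_bcontfun (ball_values V F) d =
    (if of_discrete d \<in> car V \<and> nrm V (of_discrete d) \<le> 1 then F (of_discrete d) else 0)"
  unfolding ball_values_def
proof (subst Bcontfun_inverse)
  show "(\<lambda>d. if of_discrete d \<in> car V \<and> nrm V (of_discrete d) \<le> 1 then F (of_discrete d) else 0)
      \<in> bcontfun"
    by (rule bcontfun_normI[where b = "nrm (dual V) F"])
       (auto simp: continuous_on_open_invariant open_discrete norm_le_nrm_dual[OF F]
          nrm_dual_nonneg[OF F])
qed simp

lemma ball_values_add:
  assumes "F \<in> car (dual V)" "G \<in> car (dual V)"
  shows "ball_values V (add (dual V) F G) = ball_values V F + ball_values V G"
  using assms scaled_space.add_closed[OF scaled_space_dual assms]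
  by (intro bcontfun_eqI) (simp add: ball_values add_dual)

lemma ball_values_scl_of_real:
  assumes "F \<in> car (dual V)"
  shows "ball_values V (scl (dual V) (of_real r) F) = r *\<^sub>R ball_values V F"
  using assms scaled_space.scl_closed[OF scaled_space_dual assms]
  by (intro bcontfun_eqI) (simp add: ball_values scl_dual scaleR_conv_of_real)

lemma norm_ball_values_le:
  assumes F: "F \<in> car (dual V)"
  shows "norm (ball_values V F) \<le> nrm (dual V) F"
  by (rule norm_bound) (simp add: ball_values[OF F] norm_le_nrm_dual[OF F] nrm_dual_nonneg[OF F])

lemma norm_le_norm_ball_values:
  assumes F: "F \<in> car (dual V)" and x: "x \<in> car V" "nrm V x \<le> 1"
  shows "norm (F x) \<le> norm (ball_values V F)"
  using norm_bounded[of "ball_values V F" "discrete x"] x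
  by (simp add: ball_values[OF F] discrete_inverse)

lemma nrm_dual_eq_norm_ball_values:
  assumes F: "F \<in> car (dual V)"
  shows "norm (ball_values V F) = nrm (dual V) F"
  by (intro antisym norm_ball_values_le nrm_dual_le norm_le_norm_ball_values F)

lemma inj_on_ball_values: "inj_on (ball_values V) (car (dual V))"
proof (rule inj_onI)
  fix F G assume F: "F \<in> car (dual V)" and G: "G \<in> car (dual V)"
    and eq: "ball_values V F = ball_values V G"
  interpret D: scaled_space "dual V" by (rule scaled_space_dual)
  let ?D = "add (dual V) F (scl (dual V) (of_real (- 1)) G)"
  have D: "?D \<in> car (dual V)" by (intro D.add_closed D.scl_closed F G)
  have "ball_values V ?D = 0"
    by (simp only: ball_values_add ball_values_scl_of_real D.scl_closed F G eq) simp
  then have "nrm (dual V) ?D = 0"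
    using nrm_dual_eq_norm_ball_values[OF D] by simp
  then have "?D x = 0" if "x \<in> car V" for x
    using norm_dual_le[OF D that] by simp
  then show "F = G"
    by (intro dual_eqI[OF F G]) (simp add: add_dual scl_dual)
qed

end

text \<open>
  The real functional that separates \<open>F0\<close> from \<open>S\<close> is pulled back along \<open>ball_values\<close> and made
  scalar-valued. Since \<open>S\<close> is closed under all scalars, the latter still vanishes on \<open>S\<close>.
\<close>

lemma dual_separation:
  fixes V :: "('k::{real_normed_field, euclidean_space}, 'v) nspace"
  assumes V: "scaled_space V"
    and S: "S \<subseteq> car (dual V)" "S \<noteq> {}"
    and S_add: "\<And>F G. F \<in> S \<Longrightarrow> G \<in> S \<Longrightarrow> add (dual V) F G \<in> S"
    and S_scl: "\<And>c F. F \<in> S \<Longrightarrow> scl (dual V) c F \<in> S"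
    and closed: "closed (ball_values V ` S)"
    and F0: "F0 \<in> car (dual V)" "F0 \<notin> S"
  obtains \<phi> where "\<phi> \<in> car (dual (dual V))" "\<And>F. F \<in> S \<Longrightarrow> \<phi> F = 0" "\<phi> F0 \<noteq> 0"
proof -
  interpret scaled_space V by fact
  interpret D: scaled_space "dual V" by (rule scaled_space_dual)
  let ?J = "ball_values V"
  have J_add: "?J (add (dual V) F G) = ?J F + ?J G" if "F \<in> S" "G \<in> S" for F G
    using that S(1) by (intro ball_values_add) auto
  have J_scl: "?J (scl (dual V) (of_real r) F) = r *\<^sub>R ?J F" if "F \<in> S" for r F
    using that S(1) by (intro ball_values_scl_of_real) auto
  have "subspace (?J ` S)"
    unfolding subspace_def
  proof (intro conjI allI ballI)
    obtain F where F: "F \<in> S" using S(2) by blast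
    have "0 = ?J (scl (dual V) (of_real 0) F)" using J_scl[OF F, of 0] by simp
    also have "\<dots> \<in> ?J ` S" by (intro imageI S_scl F)
    finally show "0 \<in> ?J ` S" .
  next
    fix x y assume "x \<in> ?J ` S" "y \<in> ?J ` S"
    then obtain F G where FG: "F \<in> S" "G \<in> S" and xy: "x = ?J F" "y = ?J G" by blast
    show "x + y \<in> ?J ` S"
      unfolding xy J_add[OF FG, symmetric] by (intro imageI S_add FG)
  next
    fix r :: real and x assume "x \<in> ?J ` S"
    then obtain F where F: "F \<in> S" and x: "x = ?J F" by blast
    show "r *\<^sub>R x \<in> ?J ` S"
      unfolding x J_scl[OF F, symmetric] by (intro imageI S_scl F)
  qed
  moreover have "?J F0 \<notin> ?J ` S"
    using inj_on_image_mem_iff[OF inj_on_ball_values F0(1) S(1)] F0(2) by simp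
  ultimately obtain u where u: "linear u" "\<And>x. \<bar>u x\<bar> \<le> norm x" "\<And>x. x \<in> ?J ` S \<Longrightarrow> u x = 0"
      "u (?J F0) > 0"
    using Hahn_Banach_subspace[OF _ closed] by metis
  obtain \<phi> where \<phi>: "\<phi> \<in> car (dual (dual V))"
    and \<phi>_u: "\<And>F c. F \<in> car (dual V) \<Longrightarrow> (\<phi> F * c) \<bullet> 1 = u (?J (scl (dual V) c F))"
  proof (rule dual_of_real_functional[OF scaled_space_dual, of "\<lambda>F. u (?J F)"])
    show "\<bar>u (?J F)\<bar> \<le> nrm (dual V) F" if "F \<in> car (dual V)" for F
      using u(2)[of "?J F"] norm_ball_values_le[OF that] by simp
  qed (simp_all add: ball_values_add ball_values_scl_of_real linear_add[OF u(1)] linear_scale[OF u(1)])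
  have "\<phi> F = 0" if F: "F \<in> S" for F
  proof (rule inner_mult_one_inj)
    show "(\<phi> F * c) \<bullet> 1 = 0" for c
      using F S(1) by (simp add: \<phi>_u subsetD u(3) S_scl)
  qed
  moreover have "\<phi> F0 \<noteq> 0"
    using \<phi>_u[OF F0(1), of 1] u(4) D.scl_one[OF F0(1)] by auto
  ultimately show thesis by (rule that[OF \<phi>])
qed

section \<open>Weak and weak* topologies\<close>

lemma topspace_initial_topology [simp]: "topspace (initial_topology X \<Phi>) = X"
  unfolding initial_topology_def by auto

lemma continuous_map_weak_functional:
  assumes L: "continuous_map T (weak_topology V) L" and \<phi>: "\<phi> \<in> car (dual V)" and U: "open U"
  shows "openin T {x \<in> topspace T. \<phi> (L x) \<in> U}"
proof -
  have basic: "openin (weak_topology V) {y \<in> car V. \<phi> y \<in> U}"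
    unfolding weak_topology_def initial_topology_def
    by (rule topology_generated_by_Basis) (use \<phi> U in blast)
  have "L x \<in> car V" if "x \<in> topspace T" for x
    using continuous_map_funspace[OF L] that by (auto simp: weak_topology_def)
  then have "{x \<in> topspace T. \<phi> (L x) \<in> U} = {x \<in> topspace T. L x \<in> {y \<in> car V. \<phi> y \<in> U}}"
    by auto
  then show ?thesis
    using openin_continuous_map_preimage[OF L basic] by simp
qed

lemma openin_weak_star_finite:
  assumes "openin (weak_star_topology V) U" and "F \<in> U"
  shows "\<exists>\<Phi>. finite \<Phi> \<and> \<Phi> \<subseteq> car V \<and> (\<forall>G\<in>car (dual V). (\<forall>x\<in>\<Phi>. G x = F x) \<longrightarrow> G \<in> U)"
  using openin_topology_generated_by[OF assms(1)[unfolded weak_star_topology_def initial_topology_def]]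
    assms(2)
proof (induction arbitrary: F rule: generate_topology_on.induct)
  case Empty
  then show ?case by simp
next
  case (Int a b)
  obtain \<Phi> where "finite \<Phi>" "\<Phi> \<subseteq> car V" "\<forall>G\<in>car (dual V). (\<forall>x\<in>\<Phi>. G x = F x) \<longrightarrow> G \<in> a"
    using Int.IH(1)[of F] Int.prems by blast
  moreover obtain \<Psi> where "finite \<Psi>" "\<Psi> \<subseteq> car V" "\<forall>G\<in>car (dual V). (\<forall>x\<in>\<Psi>. G x = F x) \<longrightarrow> G \<in> b"
    using Int.IH(2)[of F] Int.prems by blast
  ultimately show ?case by (intro exI[of _ "\<Phi> \<union> \<Psi>"]) auto
next
  case (UN K)
  then obtain k where "k \<in> K" "F \<in> k" by blast
  then show ?case using UN.IH[of k F] by blast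
next
  case (Basis s)
  then consider "s = car (dual V)" | x U where "x \<in> car V" "s = {G \<in> car (dual V). G x \<in> U}"
    by auto
  then show ?case
  proof cases
    case 1
    then show ?thesis by (intro exI[of _ "{}"]) simp
  next
    case (2 x U)
    then show ?thesis using Basis.prems by (intro exI[of _ "{x}"]) simp
  qed
qed

section \<open>The canonical image in the bidual\<close>

context banach_algebra
begin

abbreviation "V \<equiv> alg_space smul"
abbreviation "A' \<equiv> car (dual V)"
abbreviation "A'' \<equiv> car (dual (dual V))"
abbreviation "\<iota> \<equiv> canonical smul"

lemma alg_space_simps [simp]:
  "car V = UNIV" "add V = (+)" "scl V = smul" "nrm V = norm"
  by (simp_all add: alg_space_def)

lemma scaled_space_alg: "scaled_space V"
  by standard (auto simp: scale_right_distrib scale_left_distrib norm_scale intro: exI[of _ 0])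

sublocale A: scaled_space V by (rule scaled_space_alg)
sublocale D: scaled_space "dual V" by (rule A.scaled_space_dual)
sublocale DD: scaled_space "dual (dual V)" by (rule D.scaled_space_dual)

lemma dualD:
  assumes "f \<in> A'"
  shows "f (x + y) = f x + f y" "f (smul c x) = c * f x" "norm (f x) \<le> nrm (dual V) f * norm x"
  using dual_add[OF assms, of x y] dual_scl[OF assms, of x c] A.norm_dual_le[OF assms, of x] by simp_all

lemma in_dualI:
  assumes "\<And>x y. f (x + y) = f x + f y" "\<And>c x. f (smul c x) = c * f x"
    "\<And>x. norm (f x) \<le> B * norm x"
  shows "f \<in> A'"
  using assms by (intro A.dualI[where B = B]) simp_all

lemma canonical_apply [simp]: "f \<in> A' \<Longrightarrow> \<iota> a f = f a"
  by (simp add: canonical_def)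

lemma canonical_in_bidual: "\<iota> a \<in> A''"
proof (rule D.dualI[where B = "norm a"])
  show "\<iota> a \<in> extensional A'" by (simp add: canonical_def)
next
  fix f g assume fg: "f \<in> A'" "g \<in> A'"
  then show "\<iota> a (add (dual V) f g) = \<iota> a f + \<iota> a g"
    using D.add_closed[OF fg] by (simp add: add_dual)
next
  fix c f assume f: "f \<in> A'"
  then show "\<iota> a (scl (dual V) c f) = c * \<iota> a f"
    using D.scl_closed[OF f] by (simp add: scl_dual)
  show "norm (\<iota> a f) \<le> norm a * nrm (dual V) f"
    using f dualD(3)[OF f, of a] by (simp add: mult.commute)
qed

lemma canonical_add: "\<iota> (a + b) = add (dual (dual V)) (\<iota> a) (\<iota> b)"
  by (auto simp: canonical_def add_dual dualD)

lemma canonical_scl: "\<iota> (smul c a) = scl (dual (dual V)) c (\<iota> a)"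
  by (auto simp: canonical_def scl_dual dualD)

lemma linear_subspace_canonical: "linear_subspace (dual (dual V)) (range \<iota>)"
  unfolding linear_subspace_def
  by (auto simp: canonical_in_bidual simp flip: canonical_add canonical_scl)

text \<open>
  A real norming functional for \<open>a\<close> becomes a scalar-valued one of norm at most 1 whose value at
  \<open>a\<close> has real part \<open>norm a\<close>.
\<close>

lemma norm_le_nrm_canonical: "norm a \<le> nrm (dual (dual V)) (\<iota> a)"
proof -
  obtain u where u: "linear u" "\<And>x. \<bar>u x\<bar> \<le> norm x" "u a = norm a"
    using Hahn_Banach_norming[of a] by metis
  obtain f where f: "f \<in> A'" "\<And>x c. (f x * c) \<bullet> 1 = u (smul c x)" "\<And>x. norm (f x) \<le> norm x"
    by (rule dual_of_real_functional[OF scaled_space_alg, of u])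
       (simp_all add: u linear_add[OF u(1)] linear_scale[OF u(1)] scale_of_real)
  have "norm a = f a \<bullet> 1" using f(2)[of a 1] u(3) by simp
  also have "\<dots> \<le> norm (f a)" using norm_cauchy_schwarz[of "f a" 1] by simp
  also have "\<dots> = norm (\<iota> a f)" using f(1) by simp
  also have "\<dots> \<le> nrm (dual (dual V)) (\<iota> a)"
  proof (rule D.norm_le_nrm_dual[OF canonical_in_bidual f(1)])
    show "nrm (dual V) f \<le> 1"
      using f(3) by (intro A.nrm_dual_le) (auto intro: order_trans)
  qed
  finally show ?thesis .
qed

lemma nrm_canonical_le: "nrm (dual (dual V)) (\<iota> a) \<le> norm a"
proof (rule D.nrm_dual_le)
  fix f assume f: "f \<in> A'" "nrm (dual V) f \<le> 1"
  then show "norm (\<iota> a f) \<le> norm a"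
    using dualD(3)[OF f(1), of a] mult_right_mono[OF f(2) norm_ge_zero[of a]] by simp
qed

text \<open>
  Here the completeness of the algebra enters: the canonical embedding is isometric.
\<close>

lemma closed_ball_values_canonical: "closed (ball_values (dual V) ` range \<iota>)"
proof -
  let ?j = "\<lambda>a. ball_values (dual V) (\<iota> a)"
  have norm_j: "norm (?j a) = norm a" for a
    using D.nrm_dual_eq_norm_ball_values[OF canonical_in_bidual] norm_le_nrm_canonical nrm_canonical_le
    by (metis antisym)
  have "bounded_linear ?j"
  proof (rule bounded_linear_intro[where K = 1])
    show "?j (a + b) = ?j a + ?j b" for a b
      by (simp add: canonical_add D.ball_values_add canonical_in_bidual)
    show "?j (r *\<^sub>R a) = r *\<^sub>R ?j a" for r a
      using D.ball_values_scl_of_real[OF canonical_in_bidual]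
      by (simp add: scale_of_real[symmetric] canonical_scl)
  qed (simp add: norm_j)
  then have "complete (range ?j)"
    by (intro complete_isometric_image[where e = 1]) (simp_all add: norm_j complete_UNIV)
  then show ?thesis by (simp add: image_image complete_imp_closed)
qed

text \<open>
  This says that the canonical image is weakly closed in the bidual.
\<close>

lemma canonical_separation:
  assumes "F \<in> A''" "F \<notin> range \<iota>"
  obtains \<phi> where "\<phi> \<in> car (dual (dual (dual V)))" "\<And>a. \<phi> (\<iota> a) = 0" "\<phi> F \<noteq> 0"
proof (rule dual_separation[OF D.scaled_space_axioms _ _ _ _ closed_ball_values_canonical assms])
qed (use that in \<open>auto simp: canonical_in_bidual simp flip: canonical_add canonical_scl\<close>)

text \<open>
  If a functional vanishes on the common kernel of finitely many others, it is a linear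
  combination of them. The combination is never written down: the induction removes one
  functional \<open>h\<close> at a time by passing from \<open>g\<close> to \<open>g - (g x / h x) h\<close>, where \<open>x\<close> lies in the kernel
  of the remaining functionals and \<open>h x\<close> is not 0.
\<close>

lemma bidual_vanishes_on_span:
  assumes "finite \<Phi>" "\<Phi> \<subseteq> A'" and F: "F \<in> A''"
    and "\<And>f. f \<in> \<Phi> \<Longrightarrow> F f = 0" and "g \<in> A'"
    and "\<And>x. (\<And>f. f \<in> \<Phi> \<Longrightarrow> f x = 0) \<Longrightarrow> g x = 0"
  shows "F g = 0"
  using assms(1,2,4,5,6)
proof (induction arbitrary: g rule: finite_induct)
  case empty
  then have "g = scl (dual V) 0 g" by (auto simp: scl_dual)
  then have "F g = 0 * F g" using dual_scl[OF F empty.prems(3), of 0] by simp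
  then show ?case by simp
next
  case (insert h \<Phi>)
  have h: "h \<in> A'" and Fh: "F h = 0" and g: "g \<in> A'" using insert.prems by auto
  show ?case
  proof (cases "\<forall>x. (\<forall>f\<in>\<Phi>. f x = 0) \<longrightarrow> h x = 0")
    case True
    show ?thesis
    proof (rule insert.IH)
      fix x assume "\<And>f. f \<in> \<Phi> \<Longrightarrow> f x = 0"
      then show "g x = 0" using True by (intro insert.prems(4)) auto
    qed (use insert.prems(1-3) in auto)
  next
    case False
    then obtain x where x: "\<And>f. f \<in> \<Phi> \<Longrightarrow> f x = 0" and hx: "h x \<noteq> 0" by blast
    define c where "c = - (g x / h x)"
    let ?g = "add (dual V) g (scl (dual V) c h)"
    have "F ?g = 0"
    proof (rule insert.IH)
      fix y assume y: "\<And>f. f \<in> \<Phi> \<Longrightarrow> f y = 0"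
      define d where "d = - (h y / h x)"
      let ?z = "y + smul d x"
      have "g ?z = 0"
      proof (rule insert.prems(4))
        fix f assume "f \<in> insert h \<Phi>"
        then show "f ?z = 0"
        proof
          assume "f = h"
          then have "f ?z = h y + d * h x" using h by (simp add: dualD)
          then show ?thesis using hx by (simp add: d_def)
        next
          assume f: "f \<in> \<Phi>"
          then have "f \<in> A'" using insert.prems(1) by blast
          then show ?thesis using x[OF f] y[OF f] by (simp add: dualD)
        qed
      qed
      then have "g y + d * g x = 0" by (simp only: dualD[OF g])
      then show "?g y = 0"
        by (simp add: add_dual scl_dual c_def d_def)
    next
      show "?g \<in> A'" by (intro D.add_closed D.scl_closed g h)
    qed (use insert.prems(1-2) in auto)
    then show ?thesis
      using Fh by (simp add: dual_add[OF F] dual_scl[OF F] g h D.scl_closed)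
  qed
qed

text \<open>
  To add a functional \<open>g\<close>, the point is moved inside the common kernel of the previous
  functionals. If \<open>g\<close> vanishes on this kernel, its value is already right by
  \<open>bidual_vanishes_on_span\<close>, applied to \<open>F\<close> minus evaluation at the point.
\<close>

lemma finite_interpolation:
  assumes "finite \<Phi>" "\<Phi> \<subseteq> A'" and F: "F \<in> A''"
  shows "\<exists>a. \<forall>f\<in>\<Phi>. f a = F f"
  using assms(1,2)
proof (induction rule: finite_induct)
  case (insert g \<Phi>)
  then obtain b where b: "\<And>f. f \<in> \<Phi> \<Longrightarrow> f b = F f" by auto
  have g: "g \<in> A'" and \<Phi>: "\<Phi> \<subseteq> A'" using insert.prems by auto
  show ?case
  proof (cases "\<forall>x. (\<forall>f\<in>\<Phi>. f x = 0) \<longrightarrow> g x = 0")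
    case True
    let ?G = "add (dual (dual V)) F (\<iota> (smul (- 1) b))"
    have "?G g = 0"
    proof (rule bidual_vanishes_on_span[OF insert.hyps(1) \<Phi> _ _ g])
      show "?G \<in> A''" by (intro DD.add_closed F canonical_in_bidual)
      show "?G f = 0" if "f \<in> \<Phi>" for f
        using that \<Phi> b[OF that] dualD(2)[of f "- 1" b] by (auto simp: add_dual)
    qed (use True in blast)
    then have "g b = F g"
      using g dualD(2)[OF g, of "- 1" b] by (simp add: add_dual)
    then show ?thesis using b by blast
  next
    case False
    then obtain x where x: "\<And>f. f \<in> \<Phi> \<Longrightarrow> f x = 0" and gx: "g x \<noteq> 0" by blast
    have "f (b + smul ((F g - g b) / g x) x) = F f" if "f \<in> insert g \<Phi>" for f
      using that insert.prems b x gx by (auto simp: dualD)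
    then show ?thesis by blast
  qed
qed simp

lemma canonical_weak_star_dense:
  assumes "openin (weak_star_topology (dual V)) U" "U \<noteq> {}"
  shows "\<exists>a. \<iota> a \<in> U"
proof -
  obtain F where FU: "F \<in> U" using assms(2) by blast
  have F: "F \<in> A''"
    using openin_subset[OF assms(1)] FU by (auto simp: weak_star_topology_def)
  obtain \<Phi> where \<Phi>: "finite \<Phi>" "\<Phi> \<subseteq> A'"
      "\<forall>G\<in>A''. (\<forall>f\<in>\<Phi>. G f = F f) \<longrightarrow> G \<in> U"
    using openin_weak_star_finite[OF assms(1) FU] by blast
  obtain a where a: "\<forall>f\<in>\<Phi>. f a = F f"
    using finite_interpolation[OF \<Phi>(1,2) F] by blast
  have "\<forall>f\<in>\<Phi>. \<iota> a f = F f" using a \<Phi>(2) by (simp add: subset_iff)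
  then show ?thesis using \<Phi>(3) canonical_in_bidual by blast
qed

text \<open>
  If \<open>L F\<close> were outside the canonical image, some \<open>\<phi>\<close> in the third dual would kill this image
  but not \<open>L F\<close>. The points where \<open>\<phi> \<circ> L\<close> is nonzero form a nonempty weak* open set, which by
  density contains a point of the canonical image; but there \<open>\<phi> \<circ> L\<close> is zero.
\<close>

lemma continuous_map_preserves_canonical:
  assumes L: "continuous_map (weak_star_topology (dual V)) (weak_topology (dual (dual V))) L"
    and inv: "\<And>a. L (\<iota> a) \<in> range \<iota>" and F: "F \<in> A''"
  shows "L F \<in> range \<iota>"
proof (rule ccontr)
  assume "L F \<notin> range \<iota>"
  moreover have "L F \<in> A''"
    using continuous_map_funspace[OF L] F by (auto simp: weak_topology_def weak_star_topology_def)
  ultimately obtain \<phi> where \<phi>: "\<phi> \<in> car (dual (dual (dual V)))" "\<And>a. \<phi> (\<iota> a) = 0" "\<phi> (L F) \<noteq> 0"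
    using canonical_separation by blast
  let ?U = "{G \<in> topspace (weak_star_topology (dual V)). \<phi> (L G) \<in> - {0}}"
  have "openin (weak_star_topology (dual V)) ?U"
    by (rule continuous_map_weak_functional[OF L \<phi>(1)]) auto
  moreover have "F \<in> ?U" using F \<phi>(3) by (simp add: weak_star_topology_def)
  ultimately obtain a where "\<iota> a \<in> ?U" using canonical_weak_star_dense by blast
  moreover obtain b where "L (\<iota> a) = \<iota> b" using inv by blast
  ultimately show False using \<phi>(2) by simp
qed

section \<open>Arens products with one factor in the algebra\<close>

lemma norm_dual_mult_le:
  assumes f: "f \<in> A'"
  shows "norm (f (a * b)) \<le> nrm (dual V) f * norm a * norm b"
  using dualD(3)[OF f, of "a * b"] mult_left_mono[OF norm_mult_ineq[of a b] A.nrm_dual_nonneg[OF f]]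
  by (simp add: mult.assoc)

lemma slice_left_in_dual:
  assumes f: "f \<in> A'" shows "(\<lambda>b. f (a * b)) \<in> A'"
  by (rule in_dualI[OF _ _ norm_dual_mult_le[OF f]])
     (simp_all add: dualD[OF f] distrib_left scale_mult_right)

lemma slice_right_in_dual:
  assumes f: "f \<in> A'" shows "(\<lambda>b. f (b * a)) \<in> A'"
proof (rule in_dualI)
  show "norm (f (b * a)) \<le> (nrm (dual V) f * norm a) * norm b" for b
    using norm_dual_mult_le[OF f, of b a] by (simp add: ac_simps)
qed (simp_all add: dualD[OF f] distrib_right scale_mult_left)

text \<open>
  The outer functional in an Arens product is applied to a function of this kind. Membership in
  the dual is what allows an evaluation functional to be computed there.
\<close>

lemma bidual_slice_in_dual:
  assumes G: "G \<in> A''" and h: "\<And>a. h a \<in> A'"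
    and add: "\<And>a b x. h (a + b) x = h a x + h b x" and scl: "\<And>c a x. h (smul c a) x = c * h a x"
    and bound: "\<And>a x. norm (h a x) \<le> B * norm a * norm x"
  shows "(\<lambda>a. G (h a)) \<in> A'"
proof (rule in_dualI)
  show "G (h (a + b)) = G (h a) + G (h b)" for a b
  proof -
    have "h (a + b) = add (dual V) (h a) (h b)" by (auto simp: add add_dual)
    then show ?thesis by (simp add: dual_add[OF G] h)
  qed
  show "G (h (smul c a)) = c * G (h a)" for c a
  proof -
    have "h (smul c a) = scl (dual V) c (h a)" by (auto simp: scl scl_dual)
    then show ?thesis by (simp add: dual_scl[OF G] h)
  qed
  show "norm (G (h a)) \<le> (nrm (dual (dual V)) G * \<bar>B\<bar>) * norm a" for a
  proof -
    have "nrm (dual V) (h a) \<le> \<bar>B\<bar> * norm a"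
    proof (rule A.nrm_dual_le)
      fix x assume "nrm V x \<le> 1"
      then have "B * norm a * norm x \<le> \<bar>B\<bar> * norm a * 1"
        by (intro mult_mono) simp_all
      with bound[of a x] show "norm (h a x) \<le> \<bar>B\<bar> * norm a" by simp
    qed
    then have "nrm (dual (dual V)) G * nrm (dual V) (h a) \<le> nrm (dual (dual V)) G * (\<bar>B\<bar> * norm a)"
      using D.nrm_dual_nonneg[OF G] by (rule mult_left_mono)
    with D.norm_dual_le[OF G h, of a] show ?thesis by (simp add: mult.assoc)
  qed
qed

lemma bidual_left_slice_in_dual:
  assumes "G \<in> A''" and f: "f \<in> A'"
  shows "(\<lambda>a. G (\<lambda>b. f (a * b))) \<in> A'"
  by (rule bidual_slice_in_dual[OF assms(1) slice_left_in_dual[OF f], where B = "nrm (dual V) f"])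
     (simp_all add: dualD[OF f] distrib_right scale_mult_left norm_dual_mult_le[OF f])

lemma bidual_right_slice_in_dual:
  assumes "G \<in> A''" and f: "f \<in> A'"
  shows "(\<lambda>a. G (\<lambda>b. f (b * a))) \<in> A'"
proof (rule bidual_slice_in_dual[OF assms(1) slice_right_in_dual[OF f], where B = "nrm (dual V) f"])
  show "norm (f (x * a)) \<le> nrm (dual V) f * norm a * norm x" for a x
    using norm_dual_mult_le[OF f, of x a] by (simp add: ac_simps)
qed (simp_all add: dualD[OF f] distrib_left scale_mult_right)

text \<open>
  With one factor in the algebra both Arens products are the second adjoint of a multiplication
  operator; in particular they agree.
\<close>

lemma arens_canonical_left:
  assumes G: "G \<in> A''"
  shows "arens1 smul (\<iota> a) G = (\<lambda>f\<in>A'. G (\<lambda>b. f (a * b)))"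
    and "arens2 smul (\<iota> a) G = (\<lambda>f\<in>A'. G (\<lambda>b. f (a * b)))"
  unfolding arens1_def arens2_def
  by (simp_all add: bidual_left_slice_in_dual[OF G] slice_right_in_dual cong: restrict_cong)

lemma arens_canonical_right:
  assumes G: "G \<in> A''"
  shows "arens1 smul G (\<iota> a) = (\<lambda>f\<in>A'. G (\<lambda>b. f (b * a)))"
    and "arens2 smul G (\<iota> a) = (\<lambda>f\<in>A'. G (\<lambda>b. f (b * a)))"
  unfolding arens1_def arens2_def
  by (simp_all add: bidual_right_slice_in_dual[OF G] slice_left_in_dual cong: restrict_cong)

lemma arens_canonical_canonical: "arens1 smul (\<iota> a) (\<iota> b) = \<iota> (a * b)" "arens2 smul (\<iota> a) (\<iota> b) = \<iota> (a * b)"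
  unfolding arens_canonical_left[OF canonical_in_bidual]
  by (simp_all add: slice_left_in_dual canonical_def[of smul "a * b"] cong: restrict_cong)

lemma right_ideal_canonical:
  assumes "range \<iota> \<subseteq> Z1 smul" and m: "m \<in> {arens1 smul, arens2 smul}"
  shows "right_ideal (dual (dual V)) m (range \<iota>)"
proof -
  have "arens1 smul (\<iota> a) G \<in> range \<iota>" if G: "G \<in> A''" for a G
  proof (rule continuous_map_preserves_canonical[OF _ _ G])
    show "continuous_map (weak_star_topology (dual V)) (weak_topology (dual (dual V))) (arens1 smul (\<iota> a))"
      using assms(1) unfolding Z1_def by auto
  qed (simp add: arens_canonical_canonical)
  then show ?thesis
    using m arens_canonical_left linear_subspace_canonical unfolding right_ideal_def by auto
qed

lemma left_ideal_canonical:
  assumes "range \<iota> \<subseteq> Z2 smul" and m: "m \<in> {arens1 smul, arens2 smul}"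
  shows "left_ideal (dual (dual V)) m (range \<iota>)"
proof -
  have "arens2 smul G (\<iota> a) \<in> range \<iota>" if G: "G \<in> A''" for a G
  proof (rule continuous_map_preserves_canonical[OF _ _ G])
    show "continuous_map (weak_star_topology (dual V)) (weak_topology (dual (dual V)))
        (\<lambda>G. arens2 smul G (\<iota> a))"
      using assms(1) unfolding Z2_def by auto
  qed (simp add: arens_canonical_canonical)
  then show ?thesis
    using m arens_canonical_right linear_subspace_canonical unfolding left_ideal_def by auto
qed

end

theorem mainTheorem2:
  fixes smul :: "'k::{real_normed_field, euclidean_space} \<Rightarrow>
      'a::{real_normed_algebra, banach} \<Rightarrow> 'a"
  assumes "banach_algebra smul"
  shows "(Z1 smul = range (canonical smul) \<longrightarrow>
            (\<forall>m\<in>{arens1 smul, arens2 smul}.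
               right_ideal (bidual_of smul) m (range (canonical smul)))) \<and>
         (Z2 smul = range (canonical smul) \<longrightarrow>
            (\<forall>m\<in>{arens1 smul, arens2 smul}.
               left_ideal (bidual_of smul) m (range (canonical smul)))) \<and>
         (Z1 smul = range (canonical smul) \<and> Z2 smul = range (canonical smul) \<longrightarrow>
            (\<forall>m\<in>{arens1 smul, arens2 smul}.
               two_sided_ideal (bidual_of smul) m (range (canonical smul))))"
proof -
  interpret banach_algebra smul by fact
  show ?thesis
    unfolding two_sided_ideal_def using right_ideal_canonical left_ideal_canonical by blast
qed

end
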